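(* Let $\mathcal{A}=\{A_\sigma\}_{\sigma\in\Sigma}$ be a finite family of real $n\times n$ matrices indexed by $\Sigma=\{1,\dots,m\}$, let $\mathcal{W}$ be a finite set with $p$ elements, let $(i,\sigma)\mapsto i\cdot\sigma$ be a map from $\mathcal{W}\times\Sigma$ to $\mathcal{W}$, and let $T$ be the associated tropical Kraus map. Suppose that the multivalued eigenproblem $\lambda X\in T(X)$ (that is, $\lambda X_j\in T_j(X)$ for all $j\in\mathcal{W}$) has a solution $\lambda\in\mathbb{R}$, $X=(X_j)_{j\in\mathcal{W}}\in(\mathcal{S}_n^+)^p$, such that the matrix $\sum_{j\in\mathcal{W}}X_j$ is positive definite. Then the map $$v(z):=\sup_{j\in\mathcal{W}}\,(z^\top X_j z)^{1/2},\qquad z\in\mathbb{R}^n,$$ is a norm on $\mathbb{R}^n$, and $v(A_\sigma z)\le\sqrt{\lambda}\,v(z)$ holds for all $z\in\mathbb{R}^n$ and $\sigma\in\Sigma$. In particular, the joint spectral radius satisfies $\rho(\mathcal{A})\le\sqrt{\lambda}$.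
   Context: $\mathcal{S}_n$ is the space of real symmetric $n\times n$ matrices with the Löwner order ($P\preceq Q$ iff $Q-P$ is positive semidefinite), and $\mathcal{S}_n^+$ is the set of positive semidefinite matrices. For a finite set $\mathcal{Q}\subset\mathcal{S}_n$, $\bigvee\mathcal{Q}$ denotes the set of all minimal upper bounds of $\mathcal{Q}$, i.e. of all $S\in\mathcal{S}_n$ with $S\succeq Q$ for all $Q\in\mathcal{Q}$ and such that any $Y\in\mathcal{S}_n$ with $Y\succeq Q$ for all $Q\in\mathcal{Q}$ and $Y\preceq S$ equals $S$. The tropical Kraus map $T$ sends $X=(X_i)_{i\in\mathcal{W}}\in(\mathcal{S}_n^+)^p$ to the tuple of sets $(T_j(X))_{j\in\mathcal{W}}$, where $$T_j(X)=\bigvee\{A_\sigma^\top X_iA_\sigma : (i,\sigma)\in\mathcal{W}\times\Sigma,\ i\cdot\sigma=j\}.$$ The joint spectral radius of $\mathcal{A}$ is $\rho(\mathcal{A})=\lim_{k\to+\infty}\max_{1\le i_1,\dots,i_k\le m}\|A_{i_1}\cdots A_{i_k}\|^{1/k}$. *)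

theory Defs
  imports "HOL-Analysis.Analysis"
begin

definition symmetric_matrix :: "real ^ 'n ^ 'n \<Rightarrow> bool" where
  "symmetric_matrix S \<longleftrightarrow> transpose S = S"

definition psd_matrix :: "real ^ 'n ^ 'n \<Rightarrow> bool" where
  "psd_matrix S \<longleftrightarrow> symmetric_matrix S \<and> (\<forall>z. 0 \<le> z \<bullet> (S *v z))"

definition pd_matrix :: "real ^ 'n ^ 'n \<Rightarrow> bool" where
  "pd_matrix S \<longleftrightarrow> symmetric_matrix S \<and> (\<forall>z. z \<noteq> 0 \<longrightarrow> 0 < z \<bullet> (S *v z))"

definition loewner_le :: "real ^ 'n ^ 'n \<Rightarrow> real ^ 'n ^ 'n \<Rightarrow> bool" where
  "loewner_le P Q \<longleftrightarrow> psd_matrix (Q - P)"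

definition loewner_upper_bound :: "(real ^ 'n ^ 'n) set \<Rightarrow> real ^ 'n ^ 'n \<Rightarrow> bool" where
  "loewner_upper_bound \<Q> S \<longleftrightarrow> symmetric_matrix S \<and> (\<forall>Q\<in>\<Q>. loewner_le Q S)"

definition minimal_upper_bounds :: "(real ^ 'n ^ 'n) set \<Rightarrow> (real ^ 'n ^ 'n) set" where
  "minimal_upper_bounds \<Q> =
    {S. loewner_upper_bound \<Q> S \<and>
        (\<forall>Y. loewner_upper_bound \<Q> Y \<and> loewner_le Y S \<longrightarrow> Y = S)}"

definition tropical_kraus ::
  "(nat \<Rightarrow> real ^ 'n ^ 'n) \<Rightarrow> nat set \<Rightarrow> 'w set \<Rightarrow> ('w \<Rightarrow> nat \<Rightarrow> 'w) \<Rightarrow>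
    ('w \<Rightarrow> real ^ 'n ^ 'n) \<Rightarrow> 'w \<Rightarrow> (real ^ 'n ^ 'n) set" where
  "tropical_kraus A \<Sigma> W act X j =
    minimal_upper_bounds
      {transpose (A \<sigma>) ** X i ** A \<sigma> | i \<sigma>. i \<in> W \<and> \<sigma> \<in> \<Sigma> \<and> act i \<sigma> = j}"

definition is_norm :: "('a::real_vector \<Rightarrow> real) \<Rightarrow> bool" where
  "is_norm v \<longleftrightarrow>
    (\<forall>x. 0 \<le> v x) \<and> (\<forall>x. v x = 0 \<longleftrightarrow> x = 0) \<and>
    (\<forall>a x. v (a *\<^sub>R x) = \<bar>a\<bar> * v x) \<and> (\<forall>x y. v (x + y) \<le> v x + v y)"

definition matrix_word :: "(nat \<Rightarrow> real ^ 'n ^ 'n) \<Rightarrow> nat list \<Rightarrow> real ^ 'n ^ 'n" where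
  "matrix_word A ws = foldr (\<lambda>\<sigma> M. A \<sigma> ** M) ws (mat 1)"

text \<open>The matrix norm is the operator norm induced by the Euclidean norm; all norms on
  matrices give the same limit. The limit exists for finite nonempty \<open>\<Sigma>\<close>
  because the maxima, before taking roots, are submultiplicative in \<open>k\<close>.\<close>

definition joint_spectral_radius :: "(nat \<Rightarrow> real ^ 'n ^ 'n) \<Rightarrow> nat set \<Rightarrow> real" where
  "joint_spectral_radius A \<Sigma> =
    lim (\<lambda>k. MAX ws\<in>{ws. length ws = k \<and> set ws \<subseteq> \<Sigma>}.
      onorm ((*v) (matrix_word A ws)) powr (1 / real k))"

end

theory Submission
  imports Defs
begin

text \<open>
  Each \<open>X j\<close> is positive semidefinite, so \<open>z \<mapsto> sqrt (z \<bullet> (X j *v z))\<close> is a seminorm,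
  and \<open>v\<close> is the maximum of finitely many of them. A common null vector of all the
  \<open>X j\<close> is a null vector of their sum, which is positive definite; hence \<open>v\<close> is a norm.

  By the eigenvector equation, \<open>lam *\<^sub>R X j\<close> is an upper bound of all
  \<open>transpose (A \<sigma>) ** X i ** A \<sigma>\<close> with \<open>act i \<sigma> = j\<close>. For \<open>j = act i \<sigma>\<close> this says that the form of
  \<open>X i\<close> at \<open>A \<sigma> *v z\<close> is at most \<open>lam\<close> times the form of \<open>X j\<close> at \<open>z\<close>;
  taking roots and the supremum over \<open>i\<close> gives the contraction property of \<open>v\<close>.
  Minimality excludes that nothing has to be dominated, because the empty set has no
  minimal upper bound. This forces the alphabet to be nonempty and \<open>lam\<close> to be nonnegative.

  Along a word of length \<open>k\<close> the contraction multiplies up to the factor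
  \<open>sqrt lam ^ k\<close>. Since \<open>v\<close> is equivalent to the Euclidean norm, the operator norm of
  every product of length \<open>k\<close> is at most \<open>C * sqrt lam ^ k\<close>, and the constant disappears
  when the \<open>k\<close>-th root is taken. The limit defining the joint spectral radius exists by
  Fekete's lemma, applied to the submultiplicative sequence of maximal operator norms.
\<close>

section \<open>Fekete's lemma for submultiplicative sequences\<close>

text \<open>Constant factors are invisible to \<open>n\<close>-th roots because \<open>C powr (1 / n)\<close> tends to \<open>1\<close>.\<close>

lemma eventually_root_less_if_geometric_bound:
  fixes a :: "nat \<Rightarrow> real"
  assumes nonneg: "\<And>n. 0 \<le> a n" and "0 \<le> b" and "0 < C"
    and bound: "\<And>n. a n \<le> C * b ^ n" and "b < e"
  shows "\<forall>\<^sub>F n in sequentially. a n powr (1 / real n) < e"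
proof -
  have "(\<lambda>n. C powr (1 / real n) * b) \<longlonglongrightarrow> C powr 0 * b"
    using \<open>0 < C\<close> by (intro tendsto_intros lim_1_over_n) auto
  then have "\<forall>\<^sub>F n in sequentially. C powr (1 / real n) * b < e"
    using \<open>0 < C\<close> \<open>b < e\<close> by (intro order_tendstoD(2)[where y = "C powr 0 * b"]) auto
  then show ?thesis
    using eventually_gt_at_top[of 0]
  proof eventually_elim
    case (elim n)
    have "a n powr (1 / real n) \<le> (C * b ^ n) powr (1 / real n)"
      using nonneg bound by (intro powr_mono2) auto
    also have "\<dots> = C powr (1 / real n) * (b ^ n) powr (1 / real n)"
      using \<open>0 < C\<close> \<open>0 \<le> b\<close> by (simp add: powr_mult)
    also have "(b ^ n) powr (1 / real n) = b"
    proof (cases "b = 0")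
      case False
      with \<open>0 \<le> b\<close> \<open>0 < n\<close> show ?thesis
        by (simp add: powr_powr flip: powr_realpow)
    qed (use \<open>0 < n\<close> in simp)
    finally show ?case using elim by simp
  qed
qed

lemma submultiplicative_mult_add_le:
  fixes a :: "nat \<Rightarrow> real"
  assumes nonneg: "\<And>n. 0 \<le> a n" and submult: "\<And>k l. a (k + l) \<le> a k * a l"
  shows "a (q * d + r) \<le> a q ^ d * a r"
proof (induction d)
  case (Suc d)
  have "a (q * Suc d + r) \<le> a q * a (q * d + r)"
    using submult[of q "q * d + r"] by (simp add: algebra_simps)
  also have "\<dots> \<le> a q * (a q ^ d * a r)"
    using Suc nonneg by (intro mult_left_mono)
  finally show ?case by (simp add: mult.assoc)
qed simp

text \<open>The limit is the infimum \<open>L\<close> of the roots. If the root at some \<open>q\<close> is below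
  \<open>b\<close>, write \<open>n = q * d + r\<close> with \<open>r < q\<close>: then \<open>a n\<close> is at most \<open>b ^ n\<close> up to a
  factor that depends only on \<open>r\<close>, hence is bounded.\<close>

lemma convergent_root_if_submultiplicative:
  fixes a :: "nat \<Rightarrow> real"
  assumes nonneg: "\<And>n. 0 \<le> a n" and submult: "\<And>k l. a (k + l) \<le> a k * a l"
  shows "convergent (\<lambda>n. a n powr (1 / real n))"
proof -
  define g where "g = (\<lambda>n. a n powr (1 / real n))"
  define L where "L = Inf (g ` {1..})"
  have g_nonneg: "0 \<le> g n" for n by (simp add: g_def)
  have bdd: "bdd_below (g ` {1..})" using g_nonneg by (intro bdd_belowI[of _ 0]) auto
  have L_nonneg: "0 \<le> L" unfolding L_def by (intro cINF_greatest) (auto simp: g_nonneg)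
  have upper: "\<forall>\<^sub>F n in sequentially. g n < e" if "L < e" for e
  proof -
    define b where "b = (L + e) / 2"
    have b: "L < b" "b < e" "0 < b" using that L_nonneg by (auto simp: b_def)
    obtain q where "q \<ge> 1" "g q < b"
      using b(1) bdd unfolding L_def by (auto simp: cINF_less_iff)
    have "a q = g q ^ q"
      using \<open>q \<ge> 1\<close> nonneg[of q] unfolding g_def
      by (cases "a q = 0") (auto simp: powr_powr simp flip: powr_realpow)
    also have "\<dots> \<le> b ^ q" using \<open>g q < b\<close> g_nonneg by (intro power_mono) auto
    finally have aq: "a q \<le> b ^ q" .
    define C where "C = 1 + (\<Sum>r<q. a r / b ^ r)"
    have "0 < C" unfolding C_def using nonneg b
      by (intro add_pos_nonneg sum_nonneg) auto
    have "a n \<le> C * b ^ n" for n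
    proof -
      define d r where "d = n div q" and "r = n mod q"
      have n: "n = q * d + r" by (simp add: d_def r_def)
      have "r < q" using \<open>q \<ge> 1\<close> by (simp add: r_def)
      then have "a r / b ^ r \<le> (\<Sum>r<q. a r / b ^ r)"
        using nonneg b by (intro member_le_sum) auto
      then have "a r / b ^ r \<le> C" by (simp add: C_def)
      then have ar: "a r \<le> C * b ^ r" using b by (simp add: divide_le_eq)
      have "a n \<le> a q ^ d * a r"
        unfolding n by (rule submultiplicative_mult_add_le[OF nonneg submult])
      also have "\<dots> \<le> (b ^ q) ^ d * (C * b ^ r)"
        using aq ar nonneg b by (intro mult_mono power_mono) auto
      also have "\<dots> = C * b ^ n" by (simp add: n power_add power_mult)
      finally show ?thesis .
    qed
    from eventually_root_less_if_geometric_bound[OF nonneg _ \<open>0 < C\<close> this \<open>b < e\<close>] b(3)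
    show ?thesis by (simp add: g_def)
  qed
  have lower: "\<forall>\<^sub>F n in sequentially. e < g n" if "e < L" for e
    using eventually_ge_at_top[of 1]
  proof eventually_elim
    case (elim n)
    then have "L \<le> g n" unfolding L_def using bdd by (intro cINF_lower) auto
    with that show ?case by simp
  qed
  have "g \<longlonglongrightarrow> L" using lower upper by (rule order_tendstoI)
  then show ?thesis unfolding g_def by (rule convergentI)
qed

section \<open>Norms on Euclidean spaces\<close>

lemma is_norm_upper_equivalence:
  fixes v :: "'a::euclidean_space \<Rightarrow> real"
  assumes "is_norm v"
  obtains C where "0 < C" "\<And>z. v z \<le> C * norm z"
proof
  have scale: "v (a *\<^sub>R x) = \<bar>a\<bar> * v x" and nonneg: "0 \<le> v x"
    and triangle: "v (x + y) \<le> v x + v y" for a x y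
    using assms by (auto simp: is_norm_def)
  have v0: "v 0 = 0" using scale[of 0 0] by simp
  have v_sum: "v (\<Sum>b\<in>B. f b) \<le> (\<Sum>b\<in>B. v (f b))" if "finite B" for B and f :: "'a \<Rightarrow> 'a"
    using that by (induction B) (auto simp: v0 intro: order_trans[OF triangle])
  show "0 < 1 + (\<Sum>b\<in>Basis. v b)" by (intro add_pos_nonneg sum_nonneg nonneg) auto
  fix z :: 'a
  have "v z = v (\<Sum>b\<in>Basis. (z \<bullet> b) *\<^sub>R b)" by (simp add: euclidean_representation)
  also have "\<dots> \<le> (\<Sum>b\<in>Basis. \<bar>z \<bullet> b\<bar> * v b)" using v_sum by (simp flip: scale)
  also have "\<dots> \<le> (\<Sum>b\<in>Basis. norm z * v b)"
    by (intro sum_mono mult_right_mono nonneg Basis_le_norm)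
  also have "\<dots> \<le> (1 + (\<Sum>b\<in>Basis. v b)) * norm z"
    by (simp add: sum_distrib_left algebra_simps)
  finally show "v z \<le> (1 + (\<Sum>b\<in>Basis. v b)) * norm z" .
qed

text \<open>By the upper equivalence the norm is continuous, so it attains a positive minimum on
  the Euclidean unit sphere, which is compact.\<close>

lemma is_norm_lower_equivalence:
  fixes v :: "'a::euclidean_space \<Rightarrow> real"
  assumes "is_norm v"
  obtains c where "0 < c" "\<And>z. c * norm z \<le> v z"
proof -
  have scale: "v (a *\<^sub>R x) = \<bar>a\<bar> * v x" and nonneg: "0 \<le> v x"
    and zero_iff: "v x = 0 \<longleftrightarrow> x = 0"
    and triangle: "v (x + y) \<le> v x + v y" for a x y
    using assms by (auto simp: is_norm_def)
  obtain C where C: "0 < C" "\<And>z. v z \<le> C * norm z"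
    using is_norm_upper_equivalence[OF assms] by blast
  have "\<bar>v x - v y\<bar> \<le> C * dist x y" for x y
  proof -
    have "v x \<le> v y + v (x - y)" "v y \<le> v x + v (y - x)"
      using triangle[of y "x - y"] triangle[of x "y - x"] by auto
    moreover have "v (y - x) = v (x - y)" using scale[of "-1" "x - y"] by simp
    ultimately show ?thesis using C(2)[of "x - y"] by (auto simp: dist_norm)
  qed
  then have "C-lipschitz_on UNIV v"
    using C(1) by (intro lipschitz_onI) (auto simp: dist_real_def)
  then have "continuous_on (sphere 0 1) v"
    by (meson continuous_on_subset lipschitz_on_continuous_on subset_UNIV)
  moreover have "sphere (0::'a) 1 \<noteq> {}" by simp
  ultimately obtain x where x: "norm x = 1" and min: "\<And>y. norm y = 1 \<Longrightarrow> v x \<le> v y"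
    using continuous_attains_inf[of "sphere 0 1" v] by auto
  show thesis
  proof
    have "x \<noteq> 0" using x by auto
    then show "0 < v x" using zero_iff[of x] nonneg[of x] by simp
    fix z
    show "v x * norm z \<le> v z"
    proof (cases "z = 0")
      case False
      then have "v x \<le> v (inverse (norm z) *\<^sub>R z)" by (intro min) simp
      also have "\<dots> = v z / norm z" by (simp add: scale divide_inverse_commute)
      finally show ?thesis using False by (simp add: le_divide_eq)
    qed (simp add: nonneg)
  qed
qed

section \<open>Existence and bounds for the joint spectral radius\<close>

definition max_word_norm :: "(nat \<Rightarrow> real ^ 'n ^ 'n) \<Rightarrow> nat set \<Rightarrow> nat \<Rightarrow> real" where
  "max_word_norm A S k =
    (MAX ws\<in>{ws. length ws = k \<and> set ws \<subseteq> S}. onorm ((*v) (matrix_word A ws)))"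

lemma matrix_word_Nil [simp]: "matrix_word A [] = mat 1"
  and matrix_word_Cons [simp]: "matrix_word A (\<sigma> # ws) = A \<sigma> ** matrix_word A ws"
  by (simp_all add: matrix_word_def)

lemma matrix_word_append: "matrix_word A (us @ ws) = matrix_word A us ** matrix_word A ws"
  by (induction us) (simp_all add: matrix_mul_assoc)

lemma onorm_matrix_mul_le:
  fixes M N :: "real ^ 'n ^ 'n"
  shows "onorm ((*v) (M ** N)) \<le> onorm ((*v) M) * onorm ((*v) N)"
proof -
  have "(*v) (M ** N) = (*v) M \<circ> (*v) N" by (auto simp: matrix_vector_mul_assoc)
  then show ?thesis by (simp add: onorm_compose)
qed

lemma finite_nonempty_words:
  assumes "finite S" "S \<noteq> {}"
  shows "finite {ws. length ws = k \<and> set ws \<subseteq> S}" "{ws. length ws = k \<and> set ws \<subseteq> S} \<noteq> {}"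
proof -
  show "finite {ws. length ws = k \<and> set ws \<subseteq> S}"
    using finite_lists_length_eq[OF assms(1), of k] by (simp add: conj_commute)
  from assms(2) obtain s where "s \<in> S" by blast
  then have "replicate k s \<in> {ws. length ws = k \<and> set ws \<subseteq> S}" by auto
  then show "{ws. length ws = k \<and> set ws \<subseteq> S} \<noteq> {}" by blast
qed

lemma onorm_le_max_word_norm:
  assumes "finite S" "length ws = k" "set ws \<subseteq> S"
  shows "onorm ((*v) (matrix_word A ws)) \<le> max_word_norm A S k"
proof -
  have "S \<noteq> {} \<or> k = 0" using assms by (cases ws) auto
  moreover have "finite {ws. length ws = k \<and> set ws \<subseteq> S}"
    using finite_lists_length_eq[OF assms(1), of k] by (simp add: conj_commute)
  ultimately show ?thesis unfolding max_word_norm_def using assms by (intro Max_ge) auto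
qed

lemma max_word_norm_attained:
  assumes "finite S" "S \<noteq> {}"
  obtains ws where "length ws = k" "set ws \<subseteq> S"
    "max_word_norm A S k = onorm ((*v) (matrix_word A ws))"
proof -
  have "max_word_norm A S k \<in>
      (\<lambda>ws. onorm ((*v) (matrix_word A ws))) ` {ws. length ws = k \<and> set ws \<subseteq> S}"
    unfolding max_word_norm_def using finite_nonempty_words[OF assms, of k]
    by (intro Max_in) auto
  then show thesis using that by auto
qed

lemma max_word_norm_nonneg:
  assumes "finite S" "S \<noteq> {}"
  shows "0 \<le> max_word_norm A S k"
proof -
  obtain ws where "max_word_norm A S k = onorm ((*v) (matrix_word A ws))"
    using max_word_norm_attained[OF assms] by metis
  then show ?thesis by (simp add: onorm_pos_le)
qed

lemma max_word_norm_submultiplicative: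
  assumes "finite S" "S \<noteq> {}"
  shows "max_word_norm A S (k + l) \<le> max_word_norm A S k * max_word_norm A S l"
proof -
  obtain ws where ws: "length ws = k + l" "set ws \<subseteq> S"
    "max_word_norm A S (k + l) = onorm ((*v) (matrix_word A ws))"
    using max_word_norm_attained[OF assms] .
  define us vs where "us = take k ws" and "vs = drop k ws"
  have split: "ws = us @ vs" by (simp add: us_def vs_def)
  have us: "length us = k" "set us \<subseteq> S" and vs: "length vs = l" "set vs \<subseteq> S"
    using ws(1,2) by (auto simp: us_def vs_def dest: in_set_takeD in_set_dropD)
  have "max_word_norm A S (k + l)
      \<le> onorm ((*v) (matrix_word A us)) * onorm ((*v) (matrix_word A vs))"
    unfolding ws(3) split matrix_word_append by (rule onorm_matrix_mul_le)
  also have "\<dots> \<le> max_word_norm A S k * max_word_norm A S l"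
    using us vs assms
    by (intro mult_mono onorm_le_max_word_norm max_word_norm_nonneg onorm_pos_le) auto
  finally show ?thesis .
qed

lemma Max_root_eq_root_max_word_norm:
  assumes "finite S" "S \<noteq> {}"
  shows "(MAX ws\<in>{ws. length ws = k \<and> set ws \<subseteq> S}.
      onorm ((*v) (matrix_word A ws)) powr (1 / real k)) = max_word_norm A S k powr (1 / real k)"
proof (rule Max_eqI)
  show "finite ((\<lambda>ws. onorm ((*v) (matrix_word A ws)) powr (1 / real k)) `
      {ws. length ws = k \<and> set ws \<subseteq> S})"
    using finite_nonempty_words[OF assms] by blast
next
  fix y
  assume "y \<in> (\<lambda>ws. onorm ((*v) (matrix_word A ws)) powr (1 / real k)) `
      {ws. length ws = k \<and> set ws \<subseteq> S}"
  then show "y \<le> max_word_norm A S k powr (1 / real k)"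
    using assms by (auto intro!: powr_mono2 onorm_le_max_word_norm onorm_pos_le)
next
  obtain ws where ws: "length ws = k" "set ws \<subseteq> S"
    "max_word_norm A S k = onorm ((*v) (matrix_word A ws))"
    using max_word_norm_attained[OF assms] .
  then show "max_word_norm A S k powr (1 / real k) \<in>
      (\<lambda>ws. onorm ((*v) (matrix_word A ws)) powr (1 / real k)) `
      {ws. length ws = k \<and> set ws \<subseteq> S}"
    by auto
qed

lemma joint_spectral_radius_le_if_geometric_bound:
  assumes S: "finite S" "S \<noteq> {}" and "0 \<le> b" "0 < C"
    and bound: "\<And>k. max_word_norm A S k \<le> C * b ^ k"
  shows "joint_spectral_radius A S \<le> b"
proof -
  have jsr: "joint_spectral_radius A S = lim (\<lambda>k. max_word_norm A S k powr (1 / real k))"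
    unfolding joint_spectral_radius_def by (simp add: Max_root_eq_root_max_word_norm[OF S])
  have "convergent (\<lambda>k. max_word_norm A S k powr (1 / real k))"
    using max_word_norm_nonneg[OF S] max_word_norm_submultiplicative[OF S]
    by (rule convergent_root_if_submultiplicative)
  then have tendsto:
    "(\<lambda>k. max_word_norm A S k powr (1 / real k)) \<longlonglongrightarrow> joint_spectral_radius A S"
    by (simp add: jsr convergent_LIMSEQ_iff)
  show ?thesis
  proof (rule dense_ge)
    fix e assume "b < e"
    then have "\<forall>\<^sub>F k in sequentially. max_word_norm A S k powr (1 / real k) < e"
      using max_word_norm_nonneg[OF S] \<open>0 \<le> b\<close> \<open>0 < C\<close> bound
      by (intro eventually_root_less_if_geometric_bound)
    then have "\<forall>\<^sub>F k in sequentially. max_word_norm A S k powr (1 / real k) \<le> e"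
      by eventually_elim simp
    then show "joint_spectral_radius A S \<le> e"
      using tendsto by (intro tendsto_upperbound) auto
  qed
qed

text \<open>A norm contracted by every generator is contracted along words with the power of the
  factor, and its equivalence with the Euclidean norm turns this into a bound on operator
  norms.\<close>

lemma joint_spectral_radius_le_if_contracting_norm:
  assumes S: "finite S" "S \<noteq> {}" and v: "is_norm v" and "0 \<le> b"
    and contract: "\<And>z \<sigma>. \<sigma> \<in> S \<Longrightarrow> v (A \<sigma> *v z) \<le> b * v z"
  shows "joint_spectral_radius A S \<le> b"
proof -
  obtain C where C: "0 < C" "\<And>z. v z \<le> C * norm z"
    using is_norm_upper_equivalence[OF v] by blast
  obtain c where c: "0 < c" "\<And>z. c * norm z \<le> v z"
    using is_norm_lower_equivalence[OF v] by blast
  have word: "v (matrix_word A ws *v z) \<le> b ^ length ws * v z" if "set ws \<subseteq> S" for ws z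
    using that
  proof (induction ws)
    case (Cons \<sigma> ws)
    have "v (matrix_word A (\<sigma> # ws) *v z) = v (A \<sigma> *v (matrix_word A ws *v z))"
      by (simp add: matrix_vector_mul_assoc)
    also have "\<dots> \<le> b * v (matrix_word A ws *v z)" using Cons by (intro contract) auto
    also have "\<dots> \<le> b * (b ^ length ws * v z)"
      using Cons \<open>0 \<le> b\<close> by (intro mult_left_mono) auto
    finally show ?case by (simp add: mult.assoc)
  qed simp
  have "max_word_norm A S k \<le> (C / c) * b ^ k" for k
  proof -
    obtain ws where ws: "length ws = k" "set ws \<subseteq> S"
      "max_word_norm A S k = onorm ((*v) (matrix_word A ws))"
      using max_word_norm_attained[OF S] .
    have "norm (matrix_word A ws *v z) \<le> (C / c) * b ^ k * norm z" for z
    proof -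
      have "c * norm (matrix_word A ws *v z) \<le> b ^ k * v z"
        using c(2) word[OF ws(2)] ws(1) by (metis order_trans)
      also have "\<dots> \<le> b ^ k * (C * norm z)"
        using C(2) \<open>0 \<le> b\<close> by (intro mult_left_mono) auto
      finally show ?thesis using c(1) by (simp add: field_simps)
    qed
    then show ?thesis unfolding ws(3) by (rule onorm_le)
  qed
  then show ?thesis
    using S \<open>0 \<le> b\<close> C(1) c(1)
    by (intro joint_spectral_radius_le_if_geometric_bound[where C = "C / c"]) auto
qed

section \<open>Seminorms from positive semidefinite matrices\<close>

lemma psd_matrix_cauchy_schwarz:
  fixes S :: "real ^ 'n ^ 'n"
  assumes "psd_matrix S"
  shows "x \<bullet> (S *v y) \<le> sqrt (x \<bullet> (S *v x)) * sqrt (y \<bullet> (S *v y))"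
proof -
  define B where "B = (\<lambda>x y. x \<bullet> (S *v y))"
  have B_nonneg: "0 \<le> B z z" for z using assms by (simp add: B_def psd_matrix_def)
  have B_sym: "B y x = B x y"
    using assms unfolding B_def psd_matrix_def symmetric_matrix_def
    by (metis dot_lmul_matrix inner_commute transpose_matrix_vector)
  have "0 \<le> B (t *\<^sub>R x - s *\<^sub>R y) (t *\<^sub>R x - s *\<^sub>R y)" for s t by (rule B_nonneg)
  also have "B (t *\<^sub>R x - s *\<^sub>R y) (t *\<^sub>R x - s *\<^sub>R y)
      = t\<^sup>2 * B x x - 2 * s * t * B x y + s\<^sup>2 * B y y" for s t
    using B_sym unfolding B_def
    by (simp add: matrix_vector_mult_diff_distrib matrix_vector_mult_scaleR
        inner_diff_left inner_diff_right power2_eq_square algebra_simps)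
  finally have quadratic: "0 \<le> t\<^sup>2 * B x x - 2 * s * t * B x y + s\<^sup>2 * B y y" for s t .
  have expand: "2 * s * t * B x y \<le> t\<^sup>2 * B x x + s\<^sup>2 * B y y" for s t
    using quadratic[of t s] by linarith
  have "B x y \<le> sqrt (B x x) * sqrt (B y y)"
  proof (cases "B x x = 0 \<or> B y y = 0")
    case False
    define p q where "p = sqrt (B x x)" and "q = sqrt (B y y)"
    have pos: "0 < p" "0 < q" using False B_nonneg by (auto simp: p_def q_def less_le)
    have "p\<^sup>2 = B x x" "q\<^sup>2 = B y y" using B_nonneg by (auto simp: p_def q_def)
    with expand[of p q] have "2 * p * q * B x y \<le> q\<^sup>2 * p\<^sup>2 + p\<^sup>2 * q\<^sup>2" by simp
    then have "2 * (p * q) * B x y \<le> 2 * (p * q) * (p * q)"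
      by (simp add: power2_eq_square algebra_simps)
    then show ?thesis using pos by (simp add: p_def q_def)
  next
    case True
    \<comment> \<open>Scaling up a vector on which the form vanishes enlarges the mixed term of
      \<open>expand\<close> but not its right-hand side, so \<open>B x y\<close> cannot be positive.\<close>
    have "B x y \<le> 0"
    proof (rule ccontr)
      assume "\<not> B x y \<le> 0"
      then have pos: "0 < B x y" by simp
      from True show False
      proof
        assume "B x x = 0"
        with expand[of 1 "(B y y + 1) / (2 * B x y)"] pos show False by simp
      next
        assume "B y y = 0"
        with expand[of "(B x x + 1) / (2 * B x y)" 1] pos show False by simp
      qed
    qed
    also have "0 \<le> sqrt (B x x) * sqrt (B y y)" using B_nonneg by simp
    finally show ?thesis .
  qed
  then show ?thesis by (simp add: B_def)
qed

lemma psd_matrix_sqrt_triangle: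
  fixes S :: "real ^ 'n ^ 'n"
  assumes "psd_matrix S"
  shows "sqrt ((x + y) \<bullet> (S *v (x + y))) \<le> sqrt (x \<bullet> (S *v x)) + sqrt (y \<bullet> (S *v y))"
proof (rule real_le_lsqrt)
  have nonneg: "0 \<le> z \<bullet> (S *v z)" for z using assms by (simp add: psd_matrix_def)
  then show "0 \<le> sqrt (x \<bullet> (S *v x)) + sqrt (y \<bullet> (S *v y))" by simp
  have "(x + y) \<bullet> (S *v (x + y))
      = x \<bullet> (S *v x) + x \<bullet> (S *v y) + y \<bullet> (S *v x) + y \<bullet> (S *v y)"
    by (simp add: matrix_vector_right_distrib inner_add_left inner_add_right)
  also have "\<dots> \<le> (sqrt (x \<bullet> (S *v x)) + sqrt (y \<bullet> (S *v y)))\<^sup>2"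
    using psd_matrix_cauchy_schwarz[OF assms, of x y] psd_matrix_cauchy_schwarz[OF assms, of y x]
      nonneg by (simp add: power2_sum algebra_simps)
  finally show "(x + y) \<bullet> (S *v (x + y)) \<le> (sqrt (x \<bullet> (S *v x)) + sqrt (y \<bullet> (S *v y)))\<^sup>2" .
qed

lemma inner_sum_matrix_mult:
  fixes X :: "'w \<Rightarrow> real ^ 'n ^ 'n"
  shows "z \<bullet> ((\<Sum>j\<in>W. X j) *v z) = (\<Sum>j\<in>W. z \<bullet> (X j *v z))"
  by (induction W rule: infinite_finite_induct)
     (simp_all add: matrix_vector_mult_add_rdistrib inner_add_right)

lemma pd_sum_index_nonempty:
  fixes X :: "'w \<Rightarrow> real ^ 'n ^ 'n"
  assumes "pd_matrix (\<Sum>j\<in>W. X j)"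
  shows "W \<noteq> {}"
proof
  assume "W = {}"
  \<comment> \<open>The all-ones vector is nonzero because the dimension is at least one.\<close>
  moreover have "(1 :: real ^ 'n) \<noteq> 0" by simp
  ultimately show False using assms unfolding pd_matrix_def by (metis inner_sum_matrix_mult
      less_irrefl sum.empty)
qed

lemma is_norm_SUP_sqrt_psd:
  fixes X :: "'w \<Rightarrow> real ^ 'n ^ 'n"
  assumes "finite W" and psd: "\<And>j. j \<in> W \<Longrightarrow> psd_matrix (X j)"
    and pd: "pd_matrix (\<Sum>j\<in>W. X j)"
  shows "is_norm (\<lambda>z. SUP j\<in>W. sqrt (z \<bullet> (X j *v z)))"
proof -
  define p where "p = (\<lambda>j z. sqrt (z \<bullet> (X j *v z)))"
  define v where "v = (\<lambda>z. SUP j\<in>W. p j z)"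
  have "W \<noteq> {}" using pd by (rule pd_sum_index_nonempty)
  have form_nonneg: "0 \<le> z \<bullet> (X j *v z)" if "j \<in> W" for j z
    using psd[OF that] by (simp add: psd_matrix_def)
  have p_le: "p j z \<le> v z" if "j \<in> W" for j z
    unfolding v_def using that \<open>finite W\<close> by (intro cSUP_upper) auto
  have v_least: "v z \<le> c" if "\<And>j. j \<in> W \<Longrightarrow> p j z \<le> c" for z c
    unfolding v_def using that \<open>W \<noteq> {}\<close> by (intro cSUP_least)
  have p_nonneg: "0 \<le> p j z" if "j \<in> W" for j z using form_nonneg[OF that] by (simp add: p_def)
  have p_scale: "p j (a *\<^sub>R z) = \<bar>a\<bar> * p j z" for j a z
    by (simp add: p_def matrix_vector_mult_scaleR real_sqrt_mult flip: mult.assoc)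
  have nonneg: "0 \<le> v z" for z
    using \<open>W \<noteq> {}\<close> p_nonneg p_le by (metis all_not_in_conv order_trans)
  have v_scale_le: "v (a *\<^sub>R z) \<le> \<bar>a\<bar> * v z" for a z
    using p_le by (intro v_least) (simp add: p_scale mult_left_mono)
  have v0: "v 0 = 0" using v_scale_le[of 0 0] nonneg[of 0] by simp
  have "v (a *\<^sub>R z) = \<bar>a\<bar> * v z" for a z
  proof (cases "a = 0")
    case False
    \<comment> \<open>The reverse inequality is the same one for the inverse scalar.\<close>
    have "v z \<le> \<bar>inverse a\<bar> * v (a *\<^sub>R z)"
      using v_scale_le[of "inverse a" "a *\<^sub>R z"] False by simp
    then have "\<bar>a\<bar> * v z \<le> v (a *\<^sub>R z)" using False by (simp add: field_simps)
    with v_scale_le[of a z] show ?thesis by simp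
  qed (simp add: v0)
  moreover have "v (x + y) \<le> v x + v y" for x y
  proof (rule v_least)
    fix j assume "j \<in> W"
    then have "p j (x + y) \<le> p j x + p j y"
      unfolding p_def by (intro psd_matrix_sqrt_triangle psd)
    also have "\<dots> \<le> v x + v y" using \<open>j \<in> W\<close> by (intro add_mono p_le)
    finally show "p j (x + y) \<le> v x + v y" .
  qed
  moreover have "z = 0" if "v z = 0" for z
  proof (rule ccontr)
    assume "z \<noteq> 0"
    have "z \<bullet> (X j *v z) = 0" if "j \<in> W" for j
      using p_le[OF that, of z] p_nonneg[OF that, of z] \<open>v z = 0\<close> by (simp add: p_def)
    then have "z \<bullet> ((\<Sum>j\<in>W. X j) *v z) = 0" by (simp add: inner_sum_matrix_mult)
    with pd \<open>z \<noteq> 0\<close> show False by (auto simp: pd_matrix_def)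
  qed
  ultimately have "is_norm v" using nonneg v0 by (auto simp: is_norm_def)
  then show ?thesis by (simp add: v_def p_def)
qed

section \<open>Consequences of the eigenvector equation\<close>

lemma loewner_le_form_le:
  fixes P Q :: "real ^ 'n ^ 'n"
  assumes "loewner_le P Q"
  shows "z \<bullet> (P *v z) \<le> z \<bullet> (Q *v z)"
proof -
  have "0 \<le> z \<bullet> ((Q - P) *v z)" using assms by (simp add: loewner_le_def psd_matrix_def)
  then show ?thesis by (simp add: matrix_vector_mult_diff_rdistrib inner_diff_right)
qed

text \<open>Every symmetric matrix bounds the empty set, and subtracting the identity from one
  gives a strictly smaller bound.\<close>

lemma minimal_upper_bounds_empty: "minimal_upper_bounds ({} :: (real ^ 'n ^ 'n) set) = {}"
proof -
  have False if "S \<in> minimal_upper_bounds {}" for S :: "real ^ 'n ^ 'n"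
  proof -
    have S: "symmetric_matrix S"
      and min: "\<And>Y. symmetric_matrix Y \<Longrightarrow> loewner_le Y S \<Longrightarrow> Y = S"
      using that by (auto simp: minimal_upper_bounds_def loewner_upper_bound_def)
    have "symmetric_matrix (S - mat 1)"
      using S by (simp add: symmetric_matrix_def transpose_def mat_def vec_eq_iff)
    moreover have "loewner_le (S - mat 1) S"
      by (simp add: loewner_le_def psd_matrix_def symmetric_matrix_def)
    ultimately have "S - mat 1 = S" by (rule min)
    then have "(mat 1 :: real ^ 'n ^ 'n) = 0" by simp
    then have "mat 1 *v (1 :: real ^ 'n) = 0 *v (1 :: real ^ 'n)" by (simp only:)
    then show False by simp
  qed
  then show ?thesis by blast
qed

lemma inner_congruence:
  fixes M X :: "real ^ 'n ^ 'n"
  shows "z \<bullet> ((transpose M ** X ** M) *v z) = (M *v z) \<bullet> (X *v (M *v z))"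
  by (metis dot_lmul_matrix matrix_vector_mul_assoc transpose_matrix_vector transpose_transpose)

lemma tropical_kraus_form_le:
  assumes "S \<in> tropical_kraus A \<Sigma> W act X (act i \<sigma>)" "i \<in> W" "\<sigma> \<in> \<Sigma>"
  shows "(A \<sigma> *v z) \<bullet> (X i *v (A \<sigma> *v z)) \<le> z \<bullet> (S *v z)"
proof -
  have "loewner_le (transpose (A \<sigma>) ** X i ** A \<sigma>) S"
    using assms by (auto simp: tropical_kraus_def minimal_upper_bounds_def loewner_upper_bound_def)
  then show ?thesis using loewner_le_form_le by (fastforce simp: inner_congruence)
qed

lemma tropical_kraus_nonempty_predecessor:
  assumes "S \<in> tropical_kraus A \<Sigma> W act X j"
  obtains i \<sigma> where "i \<in> W" "\<sigma> \<in> \<Sigma>" "act i \<sigma> = j"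
proof -
  have "{transpose (A \<sigma>) ** X i ** A \<sigma> | i \<sigma>. i \<in> W \<and> \<sigma> \<in> \<Sigma> \<and> act i \<sigma> = j} \<noteq> {}"
    using assms minimal_upper_bounds_empty unfolding tropical_kraus_def by force
  then show thesis using that by blast
qed

text \<open>Each \<open>lam *\<^sub>R X j\<close> dominates some congruence of a positive semidefinite matrix, so
  \<open>lam\<close> times the positive definite sum has a nonnegative quadratic form.\<close>

lemma tropical_kraus_eigenvalue_nonneg:
  fixes X :: "'w \<Rightarrow> real ^ 'n ^ 'n"
  assumes psd: "\<And>j. j \<in> W \<Longrightarrow> psd_matrix (X j)"
    and eigen: "\<And>j. j \<in> W \<Longrightarrow> lam *\<^sub>R X j \<in> tropical_kraus A \<Sigma> W act X j"
    and pd: "pd_matrix (\<Sum>j\<in>W. X j)"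
  shows "0 \<le> lam"
proof -
  define z :: "real ^ 'n" where "z = 1"
  have "0 \<le> lam * (z \<bullet> (X j *v z))" if j: "j \<in> W" for j
  proof -
    obtain i \<sigma> where i: "i \<in> W" "\<sigma> \<in> \<Sigma>" "act i \<sigma> = j"
      using tropical_kraus_nonempty_predecessor[OF eigen[OF j]] .
    have "0 \<le> (A \<sigma> *v z) \<bullet> (X i *v (A \<sigma> *v z))"
      using psd[OF i(1)] by (simp add: psd_matrix_def)
    also have "\<dots> \<le> z \<bullet> ((lam *\<^sub>R X j) *v z)"
      using tropical_kraus_form_le i eigen[OF j] by metis
    finally show ?thesis by (simp add: scaleR_matrix_vector_assoc[symmetric])
  qed
  then have "0 \<le> lam * (z \<bullet> ((\<Sum>j\<in>W. X j) *v z))"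
    by (simp add: inner_sum_matrix_mult sum_distrib_left sum_nonneg)
  moreover have "0 < z \<bullet> ((\<Sum>j\<in>W. X j) *v z)"
    using pd unfolding pd_matrix_def z_def by (metis zero_neq_one)
  ultimately show ?thesis by (simp add: zero_le_mult_iff)
qed

lemma tropical_kraus_eigenvector_contracts:
  fixes X :: "'w \<Rightarrow> real ^ 'n ^ 'n"
  assumes "finite W" and "W \<noteq> {}" and "0 \<le> lam" and "\<sigma> \<in> \<Sigma>"
    and act: "\<And>i. i \<in> W \<Longrightarrow> act i \<sigma> \<in> W"
    and eigen: "\<And>j. j \<in> W \<Longrightarrow> lam *\<^sub>R X j \<in> tropical_kraus A \<Sigma> W act X j"
  shows "(SUP j\<in>W. sqrt ((A \<sigma> *v z) \<bullet> (X j *v (A \<sigma> *v z))))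
    \<le> sqrt lam * (SUP j\<in>W. sqrt (z \<bullet> (X j *v z)))"
proof (rule cSUP_least[OF \<open>W \<noteq> {}\<close>])
  fix i assume i: "i \<in> W"
  have "(A \<sigma> *v z) \<bullet> (X i *v (A \<sigma> *v z)) \<le> z \<bullet> ((lam *\<^sub>R X (act i \<sigma>)) *v z)"
    using eigen[OF act[OF i]] i \<open>\<sigma> \<in> \<Sigma>\<close> by (rule tropical_kraus_form_le)
  also have "\<dots> = lam * (z \<bullet> (X (act i \<sigma>) *v z))"
    by (simp add: scaleR_matrix_vector_assoc[symmetric])
  finally have "sqrt ((A \<sigma> *v z) \<bullet> (X i *v (A \<sigma> *v z)))
      \<le> sqrt lam * sqrt (z \<bullet> (X (act i \<sigma>) *v z))"
    by (simp flip: real_sqrt_mult)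
  also have "\<dots> \<le> sqrt lam * (SUP j\<in>W. sqrt (z \<bullet> (X j *v z)))"
    using \<open>finite W\<close> \<open>0 \<le> lam\<close> act[OF i]
    by (intro mult_left_mono cSUP_upper) auto
  finally show "sqrt ((A \<sigma> *v z) \<bullet> (X i *v (A \<sigma> *v z)))
      \<le> sqrt lam * (SUP j\<in>W. sqrt (z \<bullet> (X j *v z)))" .
qed

section \<open>The norm of a multivalued eigenvector\<close>

theorem theorem2:
  fixes A :: "nat \<Rightarrow> real ^ 'n ^ 'n"
    and m :: nat
    and W :: "'w set"
    and act :: "'w \<Rightarrow> nat \<Rightarrow> 'w"
    and lam :: real
    and X :: "'w \<Rightarrow> real ^ 'n ^ 'n"
  defines "v \<equiv> \<lambda>z. SUP j\<in>W. sqrt (z \<bullet> (X j *v z))"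
  assumes "finite W"
    and "\<And>i \<sigma>. i \<in> W \<Longrightarrow> \<sigma> \<in> {1..m} \<Longrightarrow> act i \<sigma> \<in> W"
    and "\<And>j. j \<in> W \<Longrightarrow> psd_matrix (X j)"
    and "\<And>j. j \<in> W \<Longrightarrow> lam *\<^sub>R X j \<in> tropical_kraus A {1..m} W act X j"
    and "pd_matrix (\<Sum>j\<in>W. X j)"
  shows "is_norm v \<and>
    (\<forall>z. \<forall>\<sigma>\<in>{1..m}. v (A \<sigma> *v z) \<le> sqrt lam * v z) \<and>
    joint_spectral_radius A {1..m} \<le> sqrt lam"
proof -
  have nonempty: "W \<noteq> {}" using assms(6) by (rule pd_sum_index_nonempty)
  have lam: "0 \<le> lam"
    using assms(4-6) by (rule tropical_kraus_eigenvalue_nonneg)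
  have norm: "is_norm v"
    unfolding v_def using assms(2,4,6) by (rule is_norm_SUP_sqrt_psd)
  have contract: "v (A \<sigma> *v z) \<le> sqrt lam * v z" if "\<sigma> \<in> {1..m}" for z \<sigma>
    unfolding v_def using assms(2) nonempty lam that assms(3)[OF _ that] assms(5)
    by (rule tropical_kraus_eigenvector_contracts)
  obtain j where "j \<in> W" using nonempty by blast
  then have "{1..m} \<noteq> {}"
    using tropical_kraus_nonempty_predecessor[OF assms(5)] by (metis empty_iff)
  then have "joint_spectral_radius A {1..m} \<le> sqrt lam"
    using lam norm contract by (intro joint_spectral_radius_le_if_contracting_norm) auto
  then show ?thesis using norm contract by blast
qed

end
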